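(* Let $V$ be a vector space of finite dimension $n$ over $\mathbb{F}_q$, and let $r$ be an integer satisfying $0<r<n$ whose parity is the opposite of that of $n$. Let $\mathcal{M}$ be an $\mathbb{F}_q$-subspace of $\mathrm{Symm}(V)$ of dimension $2n-r$ in which the rank of any non-zero element is $r$ or $n$. Then \[ A_r\geq q^n-1,\qquad A_n\leq q^{2n-r}-q^n . \] Moreover, the following two cases arise. Case (a): $r$ is odd and $n$ is even. Then \[ A_r=q^n-1,\quad A_n=q^{2n-r}-q^n,\quad |Z(\mathcal{M})|=2q^n-1,\quad |N(\mathcal{M})|=1, \] and hence for each non-zero element $u$ of $V$, $\dim\mathcal{M}_u=n-r$. If $q$ is a power of $2$, then $\dim\mathcal{M}_{\mathrm{Alt}}=n-r$. Case (b): $r$ is even and $n$ is odd. Then $|N(\mathcal{M})|\geq 2q^r-1$. Furthermore, $A_r=q^n-1$ if and only if $|N(\mathcal{M})|=2q^r-1$, if and only if $|Z(\mathcal{M})|=2q^n-1$.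
   Context: $q$ is a power of a prime and $\mathbb{F}_q$ is the field of order $q$. $\mathrm{Symm}(V)$ denotes the $\mathbb{F}_q$-vector space of all symmetric bilinear forms $f:V\times V\to\mathbb{F}_q$. The radical of $f$ is $\mathrm{rad} f=\{u\in V: f(u,v)=0\text{ for all }v\in V\}$ and $\mathrm{rank} f=\dim V-\dim\mathrm{rad} f$. For a subspace $\mathcal{M}$ of $\mathrm{Symm}(V)$: - $A_k$ denotes the number of elements of rank $k$ in $\mathcal{M}$. - For $u\in V$, $\mathcal{M}_u=\{f\in\mathcal{M}: u\in\mathrm{rad} f\}$. - $\mathcal{M}_{\mathrm{Alt}}$ is the subspace of alternating forms in $\mathcal{M}$ (those with $f(u,u)=0$ for all $u\in V$). - $Z(\mathcal{M})$ is the set of ordered pairs $(u,v)\in V\times V$ with $f(u,v)=0$ for all $f\in\mathcal{M}$. - Fix an irreducible polynomial $x^2+\lambda x+\mu$ of degree two in $\mathbb{F}_q[x]$; $N(\mathcal{M})$ is the set of ordered pairs $(u,v)\in V\times V$ with $f(u,u)+\lambda f(u,v)+\mu f(v,v)=0$ for all $f\in\mathcal{M}$. *)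

theory Defs
  imports
    "HOL-Library.Function_Algebras"
    "HOL-Library.Cardinality"
    "HOL-Computational_Algebra.Polynomial"
begin

text \<open>
  The vector space is the whole type \<open>'v\<close> with scalar multiplication \<open>scale\<close> over the field \<open>'a\<close>.
  Forms are functions \<open>'v \<Rightarrow> 'v \<Rightarrow> 'a\<close>; addition and zero of forms are the pointwise
  operations of \<open>Function_Algebras\<close>, so subspaces of forms and their dimensions are the
  library's \<^const>\<open>module.subspace\<close> and \<^const>\<open>vector_space.dim\<close> for \<open>form_scale\<close>.
\<close>

definition form_scale :: "'a::field \<Rightarrow> ('v \<Rightarrow> 'v \<Rightarrow> 'a) \<Rightarrow> 'v \<Rightarrow> 'v \<Rightarrow> 'a" where
  "form_scale c f = (\<lambda>u v. c * f u v)"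

definition bilinear_form ::
    "('a::field \<Rightarrow> 'v::ab_group_add \<Rightarrow> 'v) \<Rightarrow> ('v \<Rightarrow> 'v \<Rightarrow> 'a) \<Rightarrow> bool" where
  "bilinear_form scale f \<longleftrightarrow>
     (\<forall>v. Vector_Spaces.linear scale (*) (\<lambda>u. f u v)) \<and>
     (\<forall>u. Vector_Spaces.linear scale (*) (\<lambda>v. f u v))"

definition Symm ::
    "('a::field \<Rightarrow> 'v::ab_group_add \<Rightarrow> 'v) \<Rightarrow> ('v \<Rightarrow> 'v \<Rightarrow> 'a) set" where
  "Symm scale = {f. bilinear_form scale f \<and> (\<forall>u v. f u v = f v u)}"

definition form_rad :: "('v \<Rightarrow> 'v \<Rightarrow> 'a::zero) \<Rightarrow> 'v set" where
  "form_rad f = {u. \<forall>v. f u v = 0}"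

definition form_rank ::
    "('a::field \<Rightarrow> 'v::ab_group_add \<Rightarrow> 'v) \<Rightarrow> ('v \<Rightarrow> 'v \<Rightarrow> 'a) \<Rightarrow> nat" where
  "form_rank scale f = vector_space.dim scale UNIV - vector_space.dim scale (form_rad f)"

definition num_rank ::
    "('a::field \<Rightarrow> 'v::ab_group_add \<Rightarrow> 'v) \<Rightarrow> ('v \<Rightarrow> 'v \<Rightarrow> 'a) set \<Rightarrow> nat \<Rightarrow> nat" where
  "num_rank scale M k = card {f \<in> M. form_rank scale f = k}"

definition forms_rad_at :: "('v \<Rightarrow> 'v \<Rightarrow> 'a::zero) set \<Rightarrow> 'v \<Rightarrow> ('v \<Rightarrow> 'v \<Rightarrow> 'a) set" where
  "forms_rad_at M u = {f \<in> M. u \<in> form_rad f}"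

definition alt_forms :: "('v \<Rightarrow> 'v \<Rightarrow> 'a::zero) set \<Rightarrow> ('v \<Rightarrow> 'v \<Rightarrow> 'a) set" where
  "alt_forms M = {f \<in> M. \<forall>u. f u u = 0}"

definition Z_pairs :: "('v \<Rightarrow> 'v \<Rightarrow> 'a::zero) set \<Rightarrow> ('v \<times> 'v) set" where
  "Z_pairs M = {(u, v). \<forall>f\<in>M. f u v = 0}"

definition N_pairs :: "'a::field \<Rightarrow> 'a \<Rightarrow> ('v \<Rightarrow> 'v \<Rightarrow> 'a) set \<Rightarrow> ('v \<times> 'v) set" where
  "N_pairs lam mu M = {(u, v). \<forall>f\<in>M. f u u + lam * f u v + mu * f v v = 0}"

lemma vector_space_form_scale:
  "vector_space (form_scale :: 'a::field \<Rightarrow> ('v \<Rightarrow> 'v \<Rightarrow> 'a) \<Rightarrow> _)"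
  by unfold_locales (auto simp: form_scale_def fun_eq_iff algebra_simps)

end

theory Submission
  imports Defs "HOL-Library.Product_Plus"
begin

text \<open>
  Two double counts over \<open>M\<close> determine everything.  Write \<open>q\<close> for the order of the field, and let
  \<open>\<omega>(0) = q - 1\<close> and \<open>\<omega>(c) = -1\<close> for \<open>c \<noteq> 0\<close>.  The function \<open>\<omega>\<close> is the sum of the values of all
  nontrivial additive characters, and takes the place of characters below.  The property behind
  all counts is that \<open>\<omega>\<close> sums to zero along every nonzero linear functional.

  If \<open>e x\<close> is a linear functional of \<open>f \<in> M\<close> for each point \<open>x\<close>, then summing \<open>\<omega>(e f x)\<close> first over
  \<open>f\<close> counts the points that all of \<open>M\<close> annihilates, up to the factor \<open>(q - 1) |M|\<close>
  (\<open>double_count_annihilated\<close>).  Summing first over \<open>x\<close>, for fixed \<open>f\<close> of rank \<open>k\<close>, gives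
  \<^item> \<open>(q - 1) q^(2n - k)\<close> for \<open>x = (u, v)\<close> and \<open>e f x = f u v\<close>;
  \<^item> \<open>(q - 1) (-1)^k q^(2n - k)\<close> for \<open>e f x = f u u + \<lambda> f u v + \<mu> f v v\<close>.

  The second value (\<open>sum_weight_hermitian\<close>) is the heart of the matter.  Let \<open>E\<close> be the quadratic
  extension obtained by adjoining \<open>\<tau>\<close> with \<open>\<tau> + \<tau>' = \<lambda>\<close> and \<open>\<tau> \<tau>' = \<mu>\<close>.  Then the form
  \<open>Q (u, v) = f u u + \<lambda> f u v + \<mu> f v v\<close> on \<open>V \<times> V\<close> is the value at \<open>u + \<tau> v\<close> of the Hermitian
  extension of \<open>f\<close> to \<open>V \<otimes> E\<close>.  Hence multiplication by \<open>p \<in> E\<close> multiplies \<open>Q\<close> by the norm of \<open>p\<close>.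
  Because the norm is surjective, \<open>Q\<close> takes all nonzero values equally often, and the sum of
  \<open>\<omega>(Q w)\<close> is \<open>(q - 1) S\<close> where \<open>S\<close> is the number of zeros of \<open>Q\<close> minus the number of solutions of
  \<open>Q w = 1\<close>.  Comparing \<open>Q (w + h)\<close> with \<open>Q w\<close> gives \<open>S\<^sup>2\<close>, in the manner of a Gauss sum.  The sign of
  \<open>S\<close> follows from a congruence: \<open>E - {0}\<close> acts freely on the nonzero zeros of \<open>Q\<close>, so their number is
  divisible by \<open>q\<^sup>2 - 1\<close>, whence \<open>S\<close> is congruent to \<open>1\<close> modulo \<open>q + 1\<close>, and \<open>q\<close> is congruent to \<open>-1\<close>.
  The argument is the same in even and odd characteristic, and for alternating and other forms.

  Put \<open>a = q^r\<close> and \<open>d = q^(n - r)\<close>, so that \<open>q^n = a d\<close>, and let \<open>A\<close>, \<open>Z\<close>, \<open>N\<close> be the number of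
  elements of rank \<open>r\<close>, and the cardinalities of the two sets of pairs.  The two counts turn into
  \<^item> \<open>d (Z - (2 a d - 1)) = (d - 1) (A - (a d - 1))\<close>;
  \<^item> \<open>d (N - 1) = (d + 1) ((a d - 1) - A)\<close> if \<open>r\<close> is odd and \<open>n\<close> is even;
  \<^item> \<open>d (N - (2 a - 1)) = (d + 1) (A - (a d - 1))\<close> if \<open>r\<close> is even and \<open>n\<close> is odd.

  All pairs with a zero component lie in the first set, so \<open>Z \<ge> 2 a d - 1\<close>, and this gives
  \<open>A \<ge> q^n - 1\<close>.  If \<open>r\<close> is odd, then \<open>N \<ge> 1\<close> gives the reverse inequality and forces both sets to be
  as small as possible; if \<open>r\<close> is even, the first and third equations give the claims.  Minimality of
  the two sets then yields the dimensions of \<open>M\<^sub>u\<close> and of the space of alternating forms, by the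
  same double count over single vectors \<open>v\<close> with \<open>f u v\<close> and over \<open>u\<close> with \<open>f u u\<close>.
\<close>

section \<open>A weight that detects zeros\<close>

text \<open>
  The sum of the values at \<open>c\<close> of all nontrivial additive characters of the field.
\<close>

definition zero_weight :: "'a::{zero,finite} \<Rightarrow> int" where
  "zero_weight c = (if c = 0 then int CARD('a) - 1 else -1)"

lemma card_field_ge_2: "2 \<le> CARD('a::{field,finite})"
  using card_mono[of UNIV "{0, 1 :: 'a}"] by simp

lemma sum_zero_weight:
  fixes g :: "'b \<Rightarrow> 'a::{zero,finite}"
  assumes "finite X"
  shows "(\<Sum>x\<in>X. zero_weight (g x)) = int CARD('a) * int (card {x \<in> X. g x = 0}) - int (card X)"
proof -
  have "(\<Sum>x\<in>X. zero_weight (g x)) = (\<Sum>x\<in>X. int CARD('a) * (if g x = 0 then 1 else 0) - 1)"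
    by (rule sum.cong) (auto simp: zero_weight_def)
  also have "\<dots> = int CARD('a) * (\<Sum>x\<in>X. if g x = 0 then 1 else 0) - int (card X)"
    by (simp add: sum_subtractf sum_distrib_left)
  also have "(\<Sum>x\<in>X. if g x = 0 then 1 else 0) = int (card {x \<in> X. g x = 0})"
    using assms by (simp add: sum.If_cases Int_def)
  finally show ?thesis .
qed

lemma card_eq_sum_levels:
  fixes g :: "'b \<Rightarrow> 'a::finite"
  assumes "finite X"
  shows "card X = (\<Sum>c\<in>UNIV. card {x \<in> X. g x = c})"
  using sum.group[OF assms, of UNIV g "\<lambda>_. 1::nat"] by simp

text \<open>
  All fibres of a surjective homomorphism have the same cardinality, and the weights of all field
  elements add up to zero.  The hypotheses ask for an additive group only, so that the lemma also
  applies to additive maps that are not linear, such as \<open>u \<mapsto> f u u\<close> in characteristic 2.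
\<close>

lemma sum_zero_weight_surjective_hom:
  fixes g :: "'b::ab_group_add \<Rightarrow> 'a::{ab_group_add,finite}"
  assumes fin: "finite X"
    and add: "\<And>x y. x \<in> X \<Longrightarrow> y \<in> X \<Longrightarrow> x + y \<in> X"
    and diff: "\<And>x y. x \<in> X \<Longrightarrow> y \<in> X \<Longrightarrow> x - y \<in> X"
    and hom: "\<And>x y. x \<in> X \<Longrightarrow> y \<in> X \<Longrightarrow> g (x + y) = g x + g y"
    and surj: "g ` X = UNIV"
  shows "(\<Sum>x\<in>X. zero_weight (k + g x)) = 0"
proof -
  have le: "card {x \<in> X. g x = c} \<le> card {x \<in> X. g x = d}" for c d
  proof -
    obtain y where y: "y \<in> X" "g y = d - c"
      using surj by (metis UNIV_I image_iff)
    have "(\<lambda>x. x + y) ` {x \<in> X. g x = c} \<subseteq> {x \<in> X. g x = d}"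
      using y add hom by auto
    then show ?thesis
      using fin by (intro card_inj_on_le[where f = "\<lambda>x. x + y"]) (auto simp: inj_on_def)
  qed
  have "card {x \<in> X. g x = c} = card {x \<in> X. g x = - k}" for c
    using le by (meson le_antisym)
  then have "(\<Sum>c\<in>UNIV. card {x \<in> X. g x = c}) = (\<Sum>c\<in>(UNIV :: 'a set). card {x \<in> X. g x = - k})"
    by (rule sum.cong[OF refl])
  then have "card X = CARD('a) * card {x \<in> X. g x = - k}"
    unfolding card_eq_sum_levels[OF fin, of g] by simp
  moreover have "{x \<in> X. g x = - k} = {x \<in> X. k + g x = 0}"
    by (auto simp: add_eq_0_iff)
  ultimately show ?thesis
    by (simp add: sum_zero_weight[OF fin] flip: of_nat_mult)
qed

lemma sum_zero_weight_functional:
  fixes s :: "'a::{field,finite} \<Rightarrow> 'b::ab_group_add \<Rightarrow> 'b"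
  assumes "vector_space s" and S: "module.subspace s S" and fin: "finite S"
    and add: "\<And>x y. g (x + y) = g x + g y" and hom: "\<And>c x. g (s c x) = c * g x"
  shows "(\<Sum>x\<in>S. zero_weight (k + g x)) =
    (if \<forall>x\<in>S. g x = 0 then int (card S) * zero_weight (k::'a) else 0)"
proof (cases "\<forall>x\<in>S. g x = 0")
  case True
  then show ?thesis by simp
next
  case False
  interpret vector_space s by fact
  obtain x where x: "x \<in> S" "g x \<noteq> 0" using False by blast
  have "c \<in> g ` S" for c
  proof
    show "c = g (s (c / g x) x)" using x hom by simp
    show "s (c / g x) x \<in> S" using x S by (simp add: subspace_scale)
  qed
  then have "g ` S = UNIV" by auto
  then have "(\<Sum>x\<in>S. zero_weight (k + g x)) = 0"
    using S by (intro sum_zero_weight_surjective_hom fin) (auto intro: subspace_add subspace_diff add)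
  then show ?thesis using False by (simp only: if_False)
qed

text \<open>
  The rows of the double sum are hard to control in general, but each column is a sum along a
  linear functional on \<open>S\<close>: it vanishes unless that functional is zero.
\<close>

lemma double_count_annihilated:
  fixes s :: "'a::{field,finite} \<Rightarrow> 'b::ab_group_add \<Rightarrow> 'b"
  assumes "vector_space s" and "module.subspace s S" and "finite S" and fin: "finite X"
    and "\<And>f g x. e (f + g) x = e f x + e g x" and "\<And>c f x. e (s c f) x = c * e f x"
  shows "(\<Sum>f\<in>S. \<Sum>x\<in>X. zero_weight (e f x)) =
    (int CARD('a) - 1) * int (card S) * int (card {x \<in> X. \<forall>f\<in>S. e f x = 0})"
proof -
  have "(\<Sum>f\<in>S. \<Sum>x\<in>X. zero_weight (e f x)) = (\<Sum>x\<in>X. \<Sum>f\<in>S. zero_weight (e f x))"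
    by (rule sum.swap)
  also have "\<dots> = (\<Sum>x\<in>X. if \<forall>f\<in>S. e f x = 0 then int (card S) * (int CARD('a) - 1) else 0)"
    using sum_zero_weight_functional[OF assms(1-3), where k = 0 and g = "\<lambda>f. e f x" for x] assms(5,6)
    by (intro sum.cong refl) (simp add: zero_weight_def)
  also have "\<dots> = (int CARD('a) - 1) * int (card S) * int (card {x \<in> X. \<forall>f\<in>S. e f x = 0})"
    using fin by (simp add: sum.If_cases Int_def)
  finally show ?thesis .
qed

section \<open>Cardinality and dimension\<close>

lemma (in vector_space) card_span_independent:
  assumes "finite (UNIV :: 'a set)" and "finite B" and "independent B"
  shows "finite (span B) \<and> card (span B) = CARD('a) ^ card B"
  using assms(2,3)
proof (induction B rule: finite_induct)
  case empty
  then show ?case by simp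
next
  case (insert b B)
  have b: "b \<notin> span B" and ind: "independent B"
    using insert by (auto simp: independent_insert)
  let ?h = "\<lambda>(c, x). c *s b + x"
  have "inj_on ?h (UNIV \<times> span B)"
  proof (rule inj_onI, clarify)
    fix c x d y
    assume x: "x \<in> span B" and y: "y \<in> span B" and eq: "c *s b + x = d *s b + y"
    then have m: "(c - d) *s b = y - x"
      by (simp add: scale_left_diff_distrib algebra_simps)
    have "c = d"
    proof (rule ccontr)
      assume "c \<noteq> d"
      moreover have "inverse (c - d) *s ((c - d) *s b) \<in> span B"
        unfolding m using x y by (intro span_scale span_diff)
      ultimately show False using b by simp
    qed
    then show "c = d \<and> x = y" using eq by simp
  qed
  moreover have "?h ` (UNIV \<times> span B) = span (insert b B)"
  proof (intro equalityI subsetI)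
    fix x assume "x \<in> ?h ` (UNIV \<times> span B)"
    then obtain c y where "x = c *s b + y" "y \<in> span B" by auto
    then show "x \<in> span (insert b B)"
      unfolding span_breakdown_eq by (intro exI[of _ c]) simp
  next
    fix x assume "x \<in> span (insert b B)"
    then obtain c where "x - c *s b \<in> span B" by (auto simp: span_insert)
    then show "x \<in> ?h ` (UNIV \<times> span B)"
      by (intro image_eqI[where x = "(c, x - c *s b)"]) auto
  qed
  ultimately have "bij_betw ?h (UNIV \<times> span B) (span (insert b B))"
    by (simp add: bij_betw_def)
  from bij_betw_same_card[OF this] bij_betw_finite[OF this] show ?case
    using insert.IH[OF ind] insert.hyps assms(1) by (simp add: card_cartesian_product)
qed

lemma (in vector_space) card_subspace:
  assumes "finite (UNIV :: 'a set)" and "subspace S" and "finite S"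
  shows "card S = CARD('a) ^ dim S"
proof -
  obtain B where B: "B \<subseteq> S" "independent B" "S \<subseteq> span B" "card B = dim S"
    using basis_exists by blast
  have "span B = S" using B assms(2) by (metis span_minimal subset_antisym)
  then show ?thesis
    using card_span_independent[of B] B assms finite_subset by metis
qed

section \<open>The norm of a quadratic extension\<close>

text \<open>
  The norm of \<open>x + \<tau> y\<close>, where \<open>\<tau>\<close> is a root of \<open>X\<^sup>2 - \<lambda> X + \<mu>\<close>.  The extension field is represented by
  coordinate pairs, and only its multiplication, conjugation and norm occur.
\<close>

definition norm_form :: "'a::field \<Rightarrow> 'a \<Rightarrow> 'a \<times> 'a \<Rightarrow> 'a" where
  "norm_form lam mu = (\<lambda>(x, y). x\<^sup>2 + lam * x * y + mu * y\<^sup>2)"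

lemma norm_form_eq_0_iff:
  assumes "irreducible [:mu, lam, 1::'a::field:]"
  shows "norm_form lam mu p = 0 \<longleftrightarrow> p = 0"
proof
  obtain x y where p: "p = (x, y)" by fastforce
  assume 0: "norm_form lam mu p = 0"
  have "y = 0"
  proof (rule ccontr)
    assume y: "y \<noteq> 0"
    have "poly [:mu, lam, 1:] (x / y) = 0"
      using 0 y unfolding p norm_form_def by (simp add: field_simps power2_eq_square)
    then obtain s where s: "[:mu, lam, 1:] = [:- (x / y), 1:] * s"
      unfolding poly_eq_0_iff_dvd by (rule dvdE)
    have "degree ([:- (x / y), 1:] * s) = 2" unfolding s[symmetric] by simp
    moreover have "s \<noteq> 0" using s by auto
    ultimately have "degree s = 1" by (subst (asm) degree_mult_eq) auto
    then have "\<not> s dvd 1" using \<open>s \<noteq> 0\<close> by (simp add: is_unit_iff_degree)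
    moreover have "\<not> [:- (x / y), 1:] dvd 1" by (simp add: is_unit_iff_degree)
    ultimately show False using assms irreducibleD s by blast
  qed
  then show "p = 0" using 0 unfolding p norm_form_def by (simp add: zero_prod_def)
qed (simp add: norm_form_def zero_prod_def)

lemma bij_square_char_2:
  assumes "(2::'a::{field,finite}) = 0"
  shows "bij (\<lambda>x::'a. x\<^sup>2)"
proof -
  have "inj (\<lambda>x::'a. x\<^sup>2)"
  proof (rule injI)
    fix x y :: 'a assume "x\<^sup>2 = y\<^sup>2"
    then have "(x - y) * (x - y) = 2 * (y * y - x * y)"
      by (simp add: algebra_simps power2_eq_square)
    then show "x = y" using assms by simp
  qed
  then show ?thesis by (simp add: finite_UNIV_inj_surj bij_def)
qed

text \<open>
  In odd characteristic a zero discriminant gives a double root.  In characteristic 2 it makes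
  \<open>\<lambda> = 0\<close>, and then \<open>X\<^sup>2 + \<mu>\<close> is a square because every element is one.
\<close>

lemma discriminant_nonzero:
  assumes irr: "irreducible [:mu, lam, 1::'a::{field,finite}:]"
  shows "4 * mu - lam\<^sup>2 \<noteq> 0"
proof
  assume D: "4 * mu - lam\<^sup>2 = 0"
  \<comment> \<open>The pair \<open>(- lam, 2)\<close> gives the double root \<open>- lam / 2\<close> in homogeneous coordinates; it is
    zero only in characteristic 2.\<close>
  have "norm_form lam mu (- lam, 2) = 4 * mu - lam\<^sup>2"
    by (simp add: norm_form_def power2_eq_square algebra_simps)
  then have z: "lam = 0" "(2::'a) = 0"
    using D norm_form_eq_0_iff[OF irr] by (auto simp: zero_prod_def)
  then obtain x where "mu = x\<^sup>2"
    using bij_square_char_2 by (metis bij_pointE)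
  then have "norm_form lam mu (x, 1) = 2 * mu"
    using z by (simp add: norm_form_def)
  then show False
    using z norm_form_eq_0_iff[OF irr, of "(x, 1)"] by (simp add: zero_prod_def)
qed

text \<open>
  More than half of the field elements are squares: the nonzero fibres of squaring have at most
  two elements and the fibre over \<open>0\<close> has one.
\<close>

lemma card_squares: "CARD('a::{field,finite}) < 2 * card (range (\<lambda>x::'a. x\<^sup>2))"
proof -
  let ?R = "range (\<lambda>x::'a. x\<^sup>2)"
  have fib: "card {x::'a. x\<^sup>2 = c} \<le> 2" if c: "c \<in> ?R" for c
  proof -
    obtain a where "c = a\<^sup>2" using c by blast
    then have "{x. x\<^sup>2 = c} \<subseteq> {a, - a}" by (auto simp: power2_eq_iff)
    then have "card {x. x\<^sup>2 = c} \<le> card {a, - a}" by (intro card_mono) auto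
    also have "\<dots> \<le> 2" by (simp add: card_insert_if)
    finally show ?thesis .
  qed
  have 0: "(0::'a) \<in> ?R" by (auto intro: image_eqI[where x = 0])
  have "CARD('a) = (\<Sum>c\<in>?R. card {x::'a. x\<^sup>2 = c})"
    using sum.group[of "UNIV::'a set" ?R "\<lambda>x. x\<^sup>2" "\<lambda>_. 1::nat"] by simp
  also have "\<dots> = 1 + (\<Sum>c\<in>?R - {0}. card {x::'a. x\<^sup>2 = c})"
    using 0 by (subst sum.remove[of _ 0]) auto
  also have "\<dots> \<le> 1 + (\<Sum>c\<in>?R - {0}. 2)"
    using fib by (intro add_mono sum_mono) auto
  also have "\<dots> < 2 * card ?R"
    using 0 card_Suc_Diff1[of ?R 0] by simp
  finally show ?thesis .
qed

text \<open>
  By completing the square it suffices to solve \<open>s\<^sup>2 + D t\<^sup>2 = c\<close>, where \<open>D\<close> is the discriminant up to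
  sign.  The sets of values of \<open>s\<^sup>2\<close> and of \<open>c - D t\<^sup>2\<close> both contain more than half of the field, so
  they meet.
\<close>

lemma norm_form_surj:
  assumes irr: "irreducible [:mu, lam, 1::'a::{field,finite}:]"
  obtains p where "norm_form lam mu p = c"
proof -
  let ?D = "4 * mu - lam\<^sup>2"
  let ?R = "range (\<lambda>x::'a. x\<^sup>2)"
  let ?T = "(\<lambda>z. c - ?D * z) ` ?R"
  have "card ?T = card ?R"
    using discriminant_nonzero[OF irr] by (intro card_image) (auto simp: inj_on_def)
  then have "\<not> card ?R + card ?T \<le> CARD('a)" using card_squares[where 'a = 'a] by simp
  then have "?R \<inter> ?T \<noteq> {}"
    using card_Un_disjoint[of ?R ?T] card_mono[of UNIV "?R \<union> ?T"] by auto
  then obtain s t where "s\<^sup>2 = c - ?D * t\<^sup>2" by blast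
  moreover have "norm_form lam mu (s - lam * t, 2 * t) = s\<^sup>2 + ?D * t\<^sup>2"
    by (simp add: norm_form_def power2_eq_square algebra_simps)
  ultimately show ?thesis using that by (metis diff_add_cancel)
qed

section \<open>Coordinates for the Hermitian extension\<close>

text \<open>
  The value at \<open>u + \<tau> v\<close> of the Hermitian form that extends a symmetric form \<open>f\<close>.
\<close>

definition hermitian_form ::
    "'a::field \<Rightarrow> 'a \<Rightarrow> ('v \<Rightarrow> 'v \<Rightarrow> 'a) \<Rightarrow> 'v \<times> 'v \<Rightarrow> 'a" where
  "hermitian_form lam mu f = (\<lambda>(u, v). f u u + lam * f u v + mu * f v v)"

definition hermitian_polar ::
    "'a::field \<Rightarrow> 'a \<Rightarrow> ('v \<Rightarrow> 'v \<Rightarrow> 'a) \<Rightarrow> 'v \<times> 'v \<Rightarrow> 'v \<times> 'v \<Rightarrow> 'a" where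
  "hermitian_polar lam mu f = (\<lambda>(u, v) (u', v').
     2 * f u u' + lam * (f u v' + f v u') + 2 * mu * f v v')"

text \<open>
  Scalar multiplication of \<open>u + \<tau> v\<close> by \<open>x + \<tau> y\<close>.
\<close>

definition ext_scale ::
    "('a::field \<Rightarrow> 'v::ab_group_add \<Rightarrow> 'v) \<Rightarrow> 'a \<Rightarrow> 'a \<Rightarrow> 'a \<times> 'a \<Rightarrow> 'v \<times> 'v \<Rightarrow> 'v \<times> 'v" where
  "ext_scale s lam mu = (\<lambda>(x, y) (u, v). (s x u - s (mu * y) v, s x v + s y u + s (lam * y) v))"

text \<open>
  Multiplication of \<open>x + \<tau> y\<close> and \<open>u + \<tau> v\<close>, using \<open>\<tau>\<^sup>2 = \<lambda> \<tau> - \<mu>\<close>.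
\<close>

definition ext_mult :: "'a::field \<Rightarrow> 'a \<Rightarrow> 'a \<times> 'a \<Rightarrow> 'a \<times> 'a \<Rightarrow> 'a \<times> 'a" where
  "ext_mult lam mu = (\<lambda>(x, y) (u, v). (x * u - mu * y * v, x * v + y * u + lam * y * v))"

text \<open>
  Conjugation \<open>x + \<tau> y \<mapsto> x + (\<lambda> - \<tau>) y\<close>.
\<close>

definition ext_conj :: "'a::field \<Rightarrow> 'a \<times> 'a \<Rightarrow> 'a \<times> 'a" where
  "ext_conj lam = (\<lambda>(x, y). (x + lam * y, - y))"

lemma norm_form_ext_mult:
  "norm_form lam mu (ext_mult lam mu p p') = norm_form lam mu p * norm_form lam mu p'"
  by (cases p; cases p') (simp add: norm_form_def ext_mult_def power2_eq_square algebra_simps)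

lemma norm_form_ext_conj: "norm_form lam mu (ext_conj lam p) = norm_form lam mu p"
  by (cases p) (simp add: norm_form_def ext_conj_def power2_eq_square algebra_simps)

lemma ext_mult_conj: "ext_mult lam mu (ext_conj lam p) p = (norm_form lam mu p, 0)"
  by (cases p) (simp add: norm_form_def ext_conj_def ext_mult_def power2_eq_square algebra_simps)

section \<open>Weight sums of one symmetric form\<close>

locale finite_symmetric_form = vector_space scale
  for scale :: "'a::{field,finite} \<Rightarrow> 'v::ab_group_add \<Rightarrow> 'v" +
  fixes f :: "'v \<Rightarrow> 'v \<Rightarrow> 'a"
  assumes finite_vectors: "finite (UNIV :: 'v set)"
    and symm: "f \<in> Symm scale"
begin

lemma form_simps:
  shows form_add_left: "f (u + u') v = f u v + f u' v"
    and form_add_right: "f u (v + v') = f u v + f u v'"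
    and form_diff_left: "f (u - u') v = f u v - f u' v"
    and form_diff_right: "f u (v - v') = f u v - f u v'"
    and form_scale_left: "f (scale c u) v = c * f u v"
    and form_scale_right: "f u (scale c v) = c * f u v"
    and form_zero_left: "f 0 v = 0"
    and form_zero_right: "f u 0 = 0"
proof -
  have l: "f (u + u') v = f u v + f u' v" "f u (v + v') = f u v + f u v'"
    "f (scale c u) v = c * f u v" "f u (scale c v) = c * f u v" for u u' v v' c
    using symm by (simp_all add: Symm_def bilinear_form_def Vector_Spaces.linear_iff)
  show "f (u + u') v = f u v + f u' v" "f u (v + v') = f u v + f u v'"
    "f (scale c u) v = c * f u v" "f u (scale c v) = c * f u v"
    by (fact l)+
  show "f (u - u') v = f u v - f u' v" using l(1)[of "u - u'" u' v] by simp
  show "f u (v - v') = f u v - f u v'" using l(2)[of u "v - v'" v'] by simp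
  show "f 0 v = 0" using l(3)[of 0 0 v] by simp
  show "f u 0 = 0" using l(4)[of u 0 0] by simp
qed

lemma form_sym: "f u v = f v u"
  using symm by (simp add: Symm_def)

lemma subspace_form_rad: "subspace (form_rad f)"
  by (auto simp: subspace_def form_rad_def form_simps)

lemma card_vectors: "CARD('v) = CARD('a) ^ dim (UNIV :: 'v set)"
  using finite_vectors by (intro card_subspace) auto

lemma dim_form_rad: "dim (form_rad f) = dim (UNIV :: 'v set) - form_rank scale f"
  and form_rank_le: "form_rank scale f \<le> dim (UNIV :: 'v set)"
proof -
  have "CARD('a) ^ dim (form_rad f) \<le> CARD('a) ^ dim (UNIV :: 'v set)"
    using card_mono[OF finite_vectors, of "form_rad f"] card_vectors
      card_subspace[OF finite subspace_form_rad] finite_subset[OF _ finite_vectors] by simp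
  then have "dim (form_rad f) \<le> dim (UNIV :: 'v set)"
    using card_field_ge_2[where 'a = 'a] by (simp add: power_increasing_iff)
  then show "dim (form_rad f) = dim (UNIV :: 'v set) - form_rank scale f"
    "form_rank scale f \<le> dim (UNIV :: 'v set)"
    by (auto simp: form_rank_def)
qed

lemma card_form_rad: "card (form_rad f) = CARD('a) ^ (dim (UNIV :: 'v set) - form_rank scale f)"
  using card_subspace[OF finite subspace_form_rad] finite_subset[OF _ finite_vectors]
  by (simp add: dim_form_rad)

lemma sum_weight_row:
  "(\<Sum>v\<in>UNIV. zero_weight (f u v)) = (if u \<in> form_rad f then (int CARD('a) - 1) * int CARD('v) else 0)"
  using sum_zero_weight_functional[OF vector_space_axioms subspace_UNIV finite_vectors,
      where g = "f u" and k = 0]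
  by (simp add: form_simps form_rad_def zero_weight_def)

lemma sum_weight_pairs:
  "(\<Sum>w\<in>UNIV. zero_weight (case w of (u, v) \<Rightarrow> f u v)) =
     (int CARD('a) - 1) * int CARD('v) * int (card (form_rad f))"
proof -
  have "(\<Sum>w\<in>UNIV. zero_weight (case w of (u, v) \<Rightarrow> f u v)) = (\<Sum>u\<in>UNIV. \<Sum>v\<in>UNIV. zero_weight (f u v))"
    by (simp add: sum.cartesian_product case_prod_unfold flip: UNIV_Times_UNIV)
  also have "\<dots> = (int CARD('a) - 1) * int CARD('v) * int (card (form_rad f))"
    using finite_vectors by (simp add: sum_weight_row sum.If_cases)
  finally show ?thesis .
qed

end

section \<open>The weight sum of the Hermitian extension\<close>

lemma diff_dvd_power_diff: "x - y dvd x ^ n - y ^ n" for x y :: "'a::comm_ring_1"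
proof (induction n)
  case (Suc n)
  have "x ^ Suc n - y ^ Suc n = (x - y) * x ^ n + y * (x ^ n - y ^ n)"
    by (simp add: algebra_simps)
  then show ?case using Suc by simp
qed simp

locale finite_hermitian_form = finite_symmetric_form scale f
  for scale :: "'a::{field,finite} \<Rightarrow> 'v::ab_group_add \<Rightarrow> 'v" and f :: "'v \<Rightarrow> 'v \<Rightarrow> 'a" +
  fixes lam mu :: 'a
  assumes irr: "irreducible [:mu, lam, 1:]"
begin

abbreviation "Q \<equiv> hermitian_form lam mu f"
abbreviation "N \<equiv> norm_form lam mu"
abbreviation ext_action (infixr "\<cdot>" 75) where "ext_action \<equiv> ext_scale scale lam mu"

lemma finite_pairs: "finite (UNIV :: ('v \<times> 'v) set)"
  using finite_vectors by (simp add: finite_prod)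

lemma hermitian_form_ext_scale: "Q (p \<cdot> w) = N p * Q w"
proof -
  obtain x y u v where [simp]: "p = (x, y)" "w = (u, v)" by fastforce
  have [simp]: "f v u = f u v" by (rule form_sym)
  show ?thesis
    by (simp add: hermitian_form_def norm_form_def ext_scale_def form_simps
        power2_eq_square algebra_simps)
qed

lemma ext_scale_ext_mult: "ext_mult lam mu p p' \<cdot> w = p \<cdot> p' \<cdot> w"
  by (cases p; cases p'; cases w)
    (simp add: ext_scale_def ext_mult_def scale_left_distrib scale_left_diff_distrib
      scale_right_distrib scale_right_diff_distrib algebra_simps)

lemma ext_scale_one: "(1, 0) \<cdot> w = w"
  by (cases w) (simp add: ext_scale_def)

lemma ext_scale_inverse:
  assumes "p \<noteq> 0"
  obtains p' where "p' \<noteq> 0" "N p' = inverse (N p)" "\<And>w. p' \<cdot> p \<cdot> w = w"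
proof -
  let ?c = "inverse (N p)"
  let ?p' = "ext_mult lam mu (?c, 0) (ext_conj lam p)"
  have c: "N p \<noteq> 0" using assms norm_form_eq_0_iff[OF irr] by blast
  have n: "N ?p' = ?c"
    using c by (simp add: norm_form_ext_mult norm_form_ext_conj)
      (simp add: norm_form_def power2_eq_square)
  have "?p' \<cdot> p \<cdot> w = w" for w
    unfolding ext_scale_ext_mult ext_scale_ext_mult[symmetric, of "ext_conj lam p"] ext_mult_conj
    using c by (cases w) (simp add: ext_scale_def)
  moreover have "?p' \<noteq> 0" using n c norm_form_eq_0_iff[OF irr, of ?p'] by auto
  ultimately show ?thesis using n that by blast
qed

lemma ext_scale_diff: "(p - p') \<cdot> w = p \<cdot> w - p' \<cdot> w"
  by (cases p; cases p'; cases w)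
    (simp add: ext_scale_def scale_left_diff_distrib right_diff_distrib)

lemma ext_scale_zero: "p \<cdot> 0 = 0"
  by (cases p) (simp add: ext_scale_def zero_prod_def)

lemma inj_ext_scale_left: "w \<noteq> 0 \<Longrightarrow> inj (\<lambda>p. p \<cdot> w)"
proof (rule injI)
  fix p p' assume w: "w \<noteq> 0" and "p \<cdot> w = p' \<cdot> w"
  then have "(p - p') \<cdot> w = 0" by (simp add: ext_scale_diff)
  then have "p - p' = 0" using w ext_scale_inverse[of "p - p'"] ext_scale_zero by metis
  then show "p = p'" by simp
qed

text \<open>
  Multiplication by an element of norm \<open>e / d\<close> maps the solutions of \<open>Q w = d\<close> injectively to those
  of \<open>Q w = e\<close>.
\<close>

lemma card_level:
  assumes "c \<noteq> 0"
  shows "card {w. Q w = c} = card {w. Q w = 1}"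
proof -
  have le: "card {w. Q w = d} \<le> card {w. Q w = e}" if "d \<noteq> 0" "e \<noteq> 0" for d e
  proof -
    obtain p where p: "N p = e / d" using norm_form_surj[OF irr] by blast
    then have "p \<noteq> 0" using that norm_form_eq_0_iff[OF irr, of p] by auto
    then have "inj (\<lambda>w. p \<cdot> w)" using ext_scale_inverse by (metis injI)
    then show ?thesis
      using that finite_pairs
      by (intro card_inj_on_le[where f = "\<lambda>w. p \<cdot> w"])
        (auto simp: hermitian_form_ext_scale p intro: inj_on_subset finite_subset)
  qed
  show ?thesis using assms le by (meson le_antisym one_neq_zero)
qed

text \<open>
  The nonzero zeros of \<open>Q\<close> are a disjoint union of free orbits of the multiplicative group of the
  extension field, and this group has \<open>q\<^sup>2 - 1\<close> elements.
\<close>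

lemma card_isotropic_dvd: "int CARD('a) ^ 2 - 1 dvd int (card {w. Q w = 0}) - 1"
proof -
  let ?X = "{w. Q w = 0} - {0}"
  let ?R = "{(w, p \<cdot> w) | w p. w \<in> ?X \<and> p \<noteq> 0}"
  have mem: "(w, p \<cdot> w) \<in> ?R" if "w \<in> ?X" "p \<noteq> 0" for w p
    using that by blast
  have nz: "p \<cdot> w \<noteq> 0" if "p \<noteq> 0" "w \<noteq> 0" for p w
    using ext_scale_inverse[OF that(1)] that(2) ext_scale_zero by metis
  have "(1, 0) \<noteq> (0 :: 'a \<times> 'a)" by (simp add: zero_prod_def)
  have "refl_on ?X ?R"
  proof (rule refl_onI)
    fix w assume "w \<in> ?X"
    then show "(w, w) \<in> ?R"
      using mem[of w "(1, 0)"] \<open>(1, 0) \<noteq> 0\<close> by (simp add: ext_scale_one)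
  qed
  moreover have sub: "?R \<subseteq> ?X \<times> ?X" using nz by (auto simp: hermitian_form_ext_scale)
  moreover have "sym ?R"
  proof (rule symI)
    fix a b assume ab: "(a, b) \<in> ?R"
    then obtain p where p: "b = p \<cdot> a" "p \<noteq> 0" by blast
    have b: "b \<in> ?X" using ab sub by blast
    obtain p' where "p' \<noteq> 0" "\<And>w. p' \<cdot> p \<cdot> w = w"
      using ext_scale_inverse[OF p(2)] by blast
    then show "(b, a) \<in> ?R" using mem[OF b, of p'] by (simp add: p(1))
  qed
  moreover have "trans ?R"
  proof (rule transI)
    fix a b c assume "(a, b) \<in> ?R" "(b, c) \<in> ?R"
    then obtain p p' where p: "b = p \<cdot> a" "p \<noteq> 0" "a \<in> ?X" "c = p' \<cdot> b" "p' \<noteq> 0" by blast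
    have "c = ext_mult lam mu p' p \<cdot> a" using p by (simp add: ext_scale_ext_mult)
    moreover have "ext_mult lam mu p' p \<noteq> 0"
      using p(2,5) by (simp add: norm_form_ext_mult flip: norm_form_eq_0_iff[OF irr])
    ultimately show "(a, c) \<in> ?R" using mem[OF p(3)] by simp
  qed
  ultimately have "equiv ?X ?R" by (simp add: equiv_def)
  moreover have "CARD('a)\<^sup>2 - 1 dvd card C" if C: "C \<in> ?X // ?R" for C
  proof -
    obtain w where w: "w \<in> ?X" "C = ?R `` {w}" using C unfolding quotient_def by blast
    have "C = (\<lambda>p. p \<cdot> w) ` (UNIV - {0})"
      unfolding w(2) using w(1) by blast
    moreover have "inj_on (\<lambda>p. p \<cdot> w) (UNIV - {0})"
      using w(1) inj_on_subset[OF inj_ext_scale_left subset_UNIV] by blast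
    ultimately have "card C = card (UNIV - {0 :: 'a \<times> 'a})"
      by (simp only: card_image)
    also have "\<dots> = CARD('a)\<^sup>2 - 1"
      by (simp add: card_Diff_singleton power2_eq_square)
    finally show ?thesis by simp
  qed
  ultimately have "CARD('a)\<^sup>2 - 1 dvd card ?X"
    using equiv_imp_dvd_card[OF finite_subset[OF subset_UNIV finite_pairs]] by blast
  moreover have 0: "0 \<in> {w. Q w = 0}"
    by (simp add: hermitian_form_def zero_prod_def form_simps)
  moreover have pos: "card {w. Q w = 0} > 0"
    using 0 finite_subset[OF subset_UNIV finite_pairs, of "{w. Q w = 0}"] by (auto simp only: card_gt_0_iff)
  ultimately have "int (CARD('a)\<^sup>2 - 1) dvd int (card {w. Q w = 0} - 1)"
    by (simp only: of_nat_dvd_iff card_Diff_singleton)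
  then show ?thesis using pos by (simp add: of_nat_diff)
qed

lemma hermitian_form_add: "Q (w + h) = Q w + (Q h + hermitian_polar lam mu f w h)"
proof -
  obtain u v u' v' where [simp]: "w = (u, v)" "h = (u', v')" by fastforce
  have [simp]: "f v u = f u v" "f u' u = f u u'" "f v' u = f u v'" "f v' v = f v v'"
    "f u' v = f v u'" "f v' u' = f u' v'"
    by (rule form_sym)+
  show ?thesis by (simp add: hermitian_form_def hermitian_polar_def form_simps algebra_simps)
qed

text \<open>
  The pair \<open>(u, v)\<close> lies in the radical of the polar form iff \<open>2 u + \<lambda> v\<close> and \<open>\<lambda> u + 2 \<mu> v\<close> lie in the
  radical of \<open>f\<close>.  The determinant \<open>4 \<mu> - \<lambda>\<^sup>2\<close> of this system is not zero, because the extension is separable.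
\<close>

lemma hermitian_polar_radical:
  "(\<forall>w. hermitian_polar lam mu f w h = 0) \<longleftrightarrow> h \<in> form_rad f \<times> form_rad f"
proof
  obtain u' v' where h: "h = (u', v')" by fastforce
  assume *: "\<forall>w. hermitian_polar lam mu f w h = 0"
  have "f u' w = 0 \<and> f v' w = 0" for w
  proof -
    have 1: "2 * f w u' + lam * f w v' = 0"
      using *[rule_format, of "(w, 0)"] by (simp add: h hermitian_polar_def form_simps)
    have 2: "lam * f w u' + 2 * mu * f w v' = 0"
      using *[rule_format, of "(0, w)"] by (simp add: h hermitian_polar_def form_simps)
    have "(4 * mu - lam\<^sup>2) * f w u' =
        2 * mu * (2 * f w u' + lam * f w v') - lam * (lam * f w u' + 2 * mu * f w v')"
      "(4 * mu - lam\<^sup>2) * f w v' =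
        2 * (lam * f w u' + 2 * mu * f w v') - lam * (2 * f w u' + lam * f w v')"
      by (simp_all add: power2_eq_square algebra_simps)
    then have "f w u' = 0" "f w v' = 0"
      unfolding 1 2 using discriminant_nonzero[OF irr] by auto
    then show ?thesis using form_sym by metis
  qed
  then show "h \<in> form_rad f \<times> form_rad f" by (simp add: h form_rad_def)
next
  assume "h \<in> form_rad f \<times> form_rad f"
  moreover have "f u v = f v u" for u v by (rule form_sym)
  ultimately show "\<forall>w. hermitian_polar lam mu f w h = 0"
    by (auto simp: hermitian_polar_def form_rad_def)
qed

text \<open>
  As a function of \<open>w\<close>, the difference \<open>Q (w + h) - Q w\<close> is an affine function with linear part the
  polar form with \<open>h\<close>.  Hence the sum vanishes unless \<open>h\<close> lies in the radical, where the difference is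
  identically zero.
\<close>

lemma sum_weight_shift:
  "(\<Sum>w\<in>UNIV. zero_weight (Q (w + h) - Q w)) =
     (if h \<in> form_rad f \<times> form_rad f then (int CARD('a) - 1) * int (CARD('v) ^ 2) else 0)"
proof (cases "h \<in> form_rad f \<times> form_rad f")
  case True
  then have "Q h = 0" by (auto simp: hermitian_form_def form_rad_def)
  then have "Q (w + h) - Q w = 0" for w
    using True hermitian_polar_radical[of h] by (simp add: hermitian_form_add del: split_paired_All)
  then show ?thesis using True
    by (simp add: zero_weight_def power2_eq_square card_cartesian_product flip: UNIV_Times_UNIV)
next
  case False
  let ?B = "\<lambda>w. hermitian_polar lam mu f w h"
  obtain u v where w: "?B (u, v) \<noteq> 0" using False hermitian_polar_radical[of h] by auto
  have "c \<in> range ?B" for c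
  proof
    let ?d = "c / ?B (u, v)"
    have "?B (scale d u, scale d v) = d * ?B (u, v)" for d
      by (cases h) (simp add: hermitian_polar_def form_simps algebra_simps)
    then show "c = ?B (scale ?d u, scale ?d v)" using w by simp
  qed simp
  then have "range ?B = UNIV" by auto
  then have "(\<Sum>w\<in>UNIV. zero_weight (Q h + ?B w)) = 0"
    using finite_pairs
    by (intro sum_zero_weight_surjective_hom)
      (auto simp: hermitian_polar_def form_simps algebra_simps split: prod.splits)
  then show ?thesis using False by (simp add: hermitian_form_add if_False)
qed

text \<open>
  The square of the difference \<open>S\<close> between the number of solutions of \<open>Q w = 0\<close> and of \<open>Q w = 1\<close> comes
  from evaluating the sum of the weights of \<open>Q w' - Q w\<close> over all pairs \<open>(w, w')\<close> in two ways: by the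
  values of \<open>Q\<close>, and by the shift \<open>h = w' - w\<close>.  The sign comes from \<open>S\<close> being congruent to \<open>1\<close> modulo
  \<open>q + 1\<close>.
\<close>

lemma sum_weight_hermitian:
  "(\<Sum>w\<in>UNIV. zero_weight (Q w)) =
     (int CARD('a) - 1) * ((- 1) ^ form_rank scale f * (int CARD('v) * int (card (form_rad f))))"
proof -
  let ?q = "int CARD('a)"
  let ?W = "int CARD('v \<times> 'v)"
  define n where "n = dim (UNIV :: 'v set)"
  define k where "k = form_rank scale f"
  define a where "a c = int (card {w. Q w = c})" for c
  define S where "S = a 0 - a 1"
  have q: "?q \<ge> 2" using card_field_ge_2[where 'a = 'a] by simp
  have W: "?W = ?q ^ (2 * n)" "int CARD('v) = ?q ^ n" "int (card (form_rad f)) = ?q ^ (n - k)"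
    using card_vectors card_form_rad
    by (simp_all add: card_cartesian_product n_def k_def mult_2 power_add flip: UNIV_Times_UNIV)
  have level: "a c = a 1" if "c \<noteq> 0" for c
    using card_level[OF that] by (simp add: a_def)
  have "?W = (\<Sum>c\<in>UNIV. a c)"
    using card_eq_sum_levels[OF finite_pairs, of Q] by (simp add: a_def)
  also have "\<dots> = a 0 + (\<Sum>c\<in>UNIV - {0}. a c)"
    by (subst sum.remove[of _ 0]) auto
  also have "(\<Sum>c\<in>UNIV - {0}. a c) = (\<Sum>c\<in>UNIV - {0 :: 'a}. a 1)"
    by (intro sum.cong refl, rule level) simp
  finally have Wa: "?W = a 0 + (?q - 1) * a 1"
    by (simp add: card_Diff_singleton of_nat_diff)
  have row: "(\<Sum>w'\<in>UNIV. zero_weight (Q w' - Q w)) = (if Q w = 0 then (?q - 1) * S else - S)" for w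
  proof -
    have "(\<Sum>w'\<in>UNIV. zero_weight (Q w' - Q w)) = ?q * a (Q w) - ?W"
      using sum_zero_weight[OF finite_pairs, of "\<lambda>w'. Q w' - Q w"] by (simp add: a_def)
    then show ?thesis
      using level[of "Q w"] by (cases "Q w = 0") (simp_all only: Wa S_def, simp_all add: algebra_simps)
  qed
  have "(\<Sum>h\<in>UNIV. \<Sum>w\<in>UNIV. zero_weight (Q (w + h) - Q w)) =
      (\<Sum>w\<in>UNIV. \<Sum>h\<in>UNIV. zero_weight (Q (w + h) - Q w))"
    by (rule sum.swap)
  also have "\<dots> = (\<Sum>w\<in>UNIV. \<Sum>w'\<in>UNIV. zero_weight (Q w' - Q w))"
  proof (rule sum.cong[OF refl])
    fix w
    show "(\<Sum>h\<in>UNIV. zero_weight (Q (w + h) - Q w)) = (\<Sum>w'\<in>UNIV. zero_weight (Q w' - Q w))"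
      by (rule sum.reindex_bij_witness[of _ "\<lambda>w'. w' - w" "\<lambda>h. w + h"]) auto
  qed
  also have "\<dots> = a 0 * ((?q - 1) * S) + (?W - a 0) * (- S)"
  proof -
    have "int (card (- {w. Q w = 0})) = ?W - a 0"
      using finite_pairs card_mono[of UNIV "{w. Q w = 0}"]
        card_Diff_subset[OF finite_subset[OF subset_UNIV finite_pairs], of "{w. Q w = 0}" UNIV]
      by (simp add: a_def of_nat_diff Compl_eq_Diff_UNIV)
    then show ?thesis
      using finite_pairs by (simp add: row sum.If_cases a_def)
  qed
  also have "\<dots> = (?q - 1) * S\<^sup>2"
    unfolding Wa S_def by (simp add: power2_eq_square algebra_simps)
  finally have "(?q - 1) * S\<^sup>2 = (\<Sum>h\<in>UNIV. \<Sum>w\<in>UNIV. zero_weight (Q (w + h) - Q w))" ..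
  also have "\<dots> = (?q - 1) * (?q ^ n * ?q ^ (n - k))\<^sup>2"
    unfolding sum_weight_shift using finite_pairs W(2,3)
    by (simp add: sum.If_cases card_cartesian_product power2_eq_square algebra_simps)
  finally have "S\<^sup>2 = (?q ^ n * ?q ^ (n - k))\<^sup>2" using q by simp
  then have S: "S = ?q ^ n * ?q ^ (n - k) \<or> S = - (?q ^ n * ?q ^ (n - k))"
    by (simp add: power2_eq_iff)
  \<comment> \<open>Since \<open>q a(0) = |V|\<^sup>2 + (q - 1) S\<close> and \<open>|V|\<^sup>2 = q^(2 n)\<close>, divisibility of \<open>a(0) - 1\<close>
    by \<open>q\<^sup>2 - 1\<close> passes to \<open>(q - 1) (S - 1)\<close>.\<close>
  have dvd: "?q + 1 dvd S - 1"
  proof -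
    have "(?q - 1) * (S - 1) = ?q * (a 0 - 1) - ((?q\<^sup>2) ^ n - 1 ^ n)"
      using Wa W(1) by (simp add: S_def power_mult[symmetric] algebra_simps)
    moreover have "?q\<^sup>2 - 1 dvd ?q * (a 0 - 1) - ((?q\<^sup>2) ^ n - 1 ^ n)"
      unfolding a_def by (rule dvd_diff[OF dvd_mult[OF card_isotropic_dvd] diff_dvd_power_diff])
    moreover have "(?q - 1) * (?q + 1) = ?q\<^sup>2 - 1"
      by (simp add: power2_eq_square algebra_simps)
    ultimately have "(?q - 1) * (?q + 1) dvd (?q - 1) * (S - 1)"
      by metis
    then show ?thesis using q by simp
  qed
  define T where "T = ?q ^ n * ?q ^ (n - k)"
  define e :: int where "e = (- 1) ^ k"
  have e: "e * e = 1" "e = 1 \<or> e = - 1" by (auto simp: e_def minus_one_power_iff)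
  have "(- 1) ^ (n + (n - k)) = e"
    using form_rank_le by (simp add: n_def k_def e_def minus_one_power_iff)
  then have dvd': "?q + 1 dvd T - e"
    using diff_dvd_power_diff[of ?q "- 1" "n + (n - k)"] by (simp add: T_def power_add)
  have "S = e * T"
  proof (rule ccontr)
    \<comment> \<open>With the wrong sign, \<open>S\<close> would be congruent to both \<open>1\<close> and \<open>-1\<close> modulo \<open>q + 1 > 2\<close>.\<close>
    assume "S \<noteq> e * T"
    then have S': "S = - (e * T)"
      using S e(2) unfolding T_def[symmetric] by auto
    have "?q + 1 dvd (S - 1) + e * (T - e)"
      using dvd dvd' by (intro dvd_add dvd_mult)
    also have "(S - 1) + e * (T - e) = - 2"
      unfolding S' right_diff_distrib e(1) by simp
    finally have "?q + 1 dvd 2" by simp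
    then have "?q + 1 \<le> 2" by (intro zdvd_imp_le) auto
    then show False using q by simp
  qed
  moreover have "(\<Sum>w\<in>UNIV. zero_weight (Q w)) = (?q - 1) * S"
    using sum_zero_weight[OF finite_pairs, of Q] Wa by (simp add: a_def S_def algebra_simps)
  ultimately show ?thesis by (simp add: W T_def e_def k_def)
qed

end

section \<open>Diagonal values in characteristic 2\<close>

lemma power_2_card_imp_char_2:
  assumes "CARD('a::{field,finite}) = 2 ^ k"
  shows "(2 :: 'a) = 0"
proof -
  \<comment> \<open>Translation by \<open>1\<close> permutes the field, so \<open>1\<close> added up once per element gives \<open>0\<close>.\<close>
  have "(\<Sum>x\<in>UNIV. x + 1 :: 'a) = (\<Sum>x\<in>UNIV. x)"
    by (rule sum.reindex_bij_witness[of _ "\<lambda>x. x - 1" "\<lambda>x. x + 1"]) auto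
  then have "of_nat CARD('a) = (0 :: 'a)"
    by (simp add: sum.distrib)
  then show ?thesis using assms by simp
qed

text \<open>
  In characteristic 2 the map \<open>u \<mapsto> f u u\<close> is additive, and it satisfies \<open>f (x u) (x u) = x\<^sup>2 f u u\<close>.
  Every field element is a square, so it is surjective as soon as it is not zero.
\<close>

lemma (in finite_symmetric_form) sum_weight_diagonal:
  assumes char2: "(2 :: 'a) = 0"
  shows "(\<Sum>u\<in>UNIV. zero_weight (f u u)) =
    (if \<forall>u. f u u = 0 then (int CARD('a) - 1) * int CARD('v) else 0)"
proof (cases "\<forall>u. f u u = 0")
  case True
  then show ?thesis by (simp add: zero_weight_def)
next
  case False
  then obtain u where u: "f u u \<noteq> 0" by blast
  have "c \<in> range (\<lambda>u. f u u)" for c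
  proof -
    obtain x where "x\<^sup>2 = c / f u u"
      using bij_square_char_2[OF char2] by (metis bij_pointE)
    then have "c = f (scale x u) (scale x u)"
      using u by (simp add: form_simps power2_eq_square flip: mult.assoc)
    then show ?thesis by (rule range_eqI)
  qed
  then have surj: "range (\<lambda>u. f u u) = UNIV" by auto
  have hom: "f (u + v) (u + v) = f u u + f v v" for u v
  proof -
    have "f (u + v) (u + v) = f u u + f v v + 2 * f u v"
      using form_sym[of v u] by (simp add: form_simps)
    then show ?thesis using char2 by simp
  qed
  have "(\<Sum>u\<in>UNIV. zero_weight (0 + f u u)) = 0"
    by (rule sum_zero_weight_surjective_hom) (use finite_vectors hom surj in auto)
  then show ?thesis using False by (simp only: add_0 if_False)
qed

section \<open>Double counts over a space of symmetric forms\<close>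

locale finite_form_space = vector_space scale
  for scale :: "'a::{field,finite} \<Rightarrow> 'v::ab_group_add \<Rightarrow> 'v" +
  fixes M :: "('v \<Rightarrow> 'v \<Rightarrow> 'a) set"
  assumes finite_vectors: "finite (UNIV :: 'v set)"
    and symm: "M \<subseteq> Symm scale"
    and subspace_forms: "module.subspace form_scale M"
    and finite_forms: "finite M"
begin

lemma form: "f \<in> M \<Longrightarrow> finite_symmetric_form scale f"
  using finite_vectors symm by unfold_locales auto

lemma double_count:
  assumes "finite X" and "\<And>f g x. e (f + g) x = e f x + e g x"
    and "\<And>c f x. e (form_scale c f) x = c * e f x"
    and "\<And>f. f \<in> M \<Longrightarrow> (\<Sum>x\<in>X. zero_weight (e f x :: 'a)) = (int CARD('a) - 1) * s f"
  shows "int (card M) * int (card {x \<in> X. \<forall>f\<in>M. e f x = 0}) = (\<Sum>f\<in>M. s f)"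
proof -
  have "(int CARD('a) - 1) * (\<Sum>f\<in>M. s f) = (\<Sum>f\<in>M. \<Sum>x\<in>X. zero_weight (e f x))"
    by (simp add: assms(4) sum_distrib_left)
  also have "\<dots> = (int CARD('a) - 1) * int (card M) * int (card {x \<in> X. \<forall>f\<in>M. e f x = 0})"
    by (rule double_count_annihilated[OF vector_space_form_scale subspace_forms finite_forms, where e = e])
      (fact assms)+
  finally show ?thesis using card_field_ge_2[where 'a = 'a] by simp
qed

lemma card_Z_pairs:
  "int (card M) * int (card (Z_pairs M)) = (\<Sum>f\<in>M. int CARD('v) * int (card (form_rad f)))"
proof -
  have "Z_pairs M = {w \<in> UNIV. \<forall>f\<in>M. (case w of (u, v) \<Rightarrow> f u v) = 0}"
    by (auto simp: Z_pairs_def)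
  then show ?thesis
    using finite_vectors
    by (simp only:, intro double_count)
      (auto simp: form_scale_def finite_symmetric_form.sum_weight_pairs[OF form] finite_prod
        split: prod.splits)
qed

lemma card_N_pairs:
  assumes "irreducible [:mu, lam, 1:]"
  shows "int (card M) * int (card (N_pairs lam mu M)) =
    (\<Sum>f\<in>M. (- 1) ^ form_rank scale f * (int CARD('v) * int (card (form_rad f))))"
proof -
  have herm: "finite_hermitian_form scale f lam mu" if "f \<in> M" for f
    using form[OF that] assms by (simp add: finite_hermitian_form_def finite_hermitian_form_axioms_def)
  have "N_pairs lam mu M = {w \<in> UNIV. \<forall>f\<in>M. hermitian_form lam mu f w = 0}"
    by (auto simp: N_pairs_def hermitian_form_def)
  moreover have "int (card M) * int (card {w \<in> UNIV. \<forall>f\<in>M. hermitian_form lam mu f w = 0}) =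
      (\<Sum>f\<in>M. (- 1) ^ form_rank scale f * (int CARD('v) * int (card (form_rad f))))"
  proof (rule double_count)
    show "finite (UNIV :: ('v \<times> 'v) set)" using finite_vectors by (simp add: finite_prod)
    show "(\<Sum>w\<in>UNIV. zero_weight (hermitian_form lam mu f w)) =
        (int CARD('a) - 1) * ((- 1) ^ form_rank scale f * (int CARD('v) * int (card (form_rad f))))"
      if "f \<in> M" for f
      by (rule finite_hermitian_form.sum_weight_hermitian[OF herm[OF that]])
  qed (auto simp: hermitian_form_def form_scale_def algebra_simps)
  ultimately show ?thesis by simp
qed

text \<open>
  The hypothesis says that the map from \<open>M\<close> to the dual space which sends \<open>f\<close> to \<open>f u\<close> is onto; its
  kernel is \<open>forms_rad_at M u\<close>.
\<close>

lemma card_forms_rad_at: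
  assumes "\<And>v. (\<forall>f\<in>M. f u v = 0) \<Longrightarrow> v = 0"
  shows "int (card M) = int CARD('v) * int (card (forms_rad_at M u))"
proof -
  have "int (card M) * int (card {v \<in> UNIV. \<forall>f\<in>M. f u v = 0}) =
      (\<Sum>f\<in>M. if u \<in> form_rad f then int CARD('v) else 0)"
    using finite_vectors
    by (intro double_count) (auto simp: form_scale_def finite_symmetric_form.sum_weight_row[OF form])
  moreover have "{v \<in> UNIV. \<forall>f\<in>M. f u v = 0} = {0}"
    using assms finite_symmetric_form.form_zero_right[OF form] by blast
  moreover have "(\<Sum>f\<in>M. if u \<in> form_rad f then int CARD('v) else 0) =
      int CARD('v) * int (card (forms_rad_at M u))"
    using finite_forms by (simp add: sum.If_cases forms_rad_at_def Int_def)
  ultimately show ?thesis by simp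
qed

text \<open>
  The diagonal map sends \<open>f\<close> to the additive function \<open>u \<mapsto> f u u\<close>, with kernel the alternating forms.
  The hypothesis makes its image as large as possible.
\<close>

lemma card_alt_forms:
  assumes "(2 :: 'a) = 0" and "\<And>u. (\<forall>f\<in>M. f u u = 0) \<Longrightarrow> u = 0"
  shows "int (card M) = int CARD('v) * int (card (alt_forms M))"
proof -
  have "int (card M) * int (card {u \<in> UNIV. \<forall>f\<in>M. f u u = 0}) =
      (\<Sum>f\<in>M. if \<forall>u. f u u = 0 then int CARD('v) else 0)"
    using finite_vectors
    by (intro double_count)
      (auto simp: form_scale_def finite_symmetric_form.sum_weight_diagonal[OF form assms(1)])
  moreover have "{u \<in> UNIV. \<forall>f\<in>M. f u u = 0} = {0}"
    using assms(2) finite_symmetric_form.form_zero_right[OF form] by blast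
  moreover have "(\<Sum>f\<in>M. if \<forall>u. f u u = 0 then int CARD('v) else 0) =
      int CARD('v) * int (card (alt_forms M))"
    using finite_forms by (simp add: sum.If_cases alt_forms_def Int_def)
  ultimately show ?thesis by simp
qed

lemma card_trivial_pairs: "card (UNIV \<times> {0} \<union> {0 :: 'v} \<times> UNIV :: ('v \<times> 'v) set) = 2 * CARD('v) - 1"
proof -
  have "UNIV \<times> {0} \<inter> {0 :: 'v} \<times> UNIV = {(0, 0 :: 'v)}" by auto
  then show ?thesis
    using finite_vectors card_Un_Int[of "UNIV \<times> {0 :: 'v}" "{0 :: 'v} \<times> UNIV"]
    by (simp add: card_cartesian_product)
qed

lemma trivial_pairs_subset: "UNIV \<times> {0} \<union> {0} \<times> UNIV \<subseteq> Z_pairs M"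
  using finite_symmetric_form.form_zero_left[OF form] finite_symmetric_form.form_zero_right[OF form]
  by (auto simp: Z_pairs_def)

end

section \<open>Spaces of dimension 2n - r with ranks r and n\<close>

text \<open>
  The dimension of an infinite-dimensional space is \<open>0\<close> by convention, so a positive dimension
  provides a finite basis.
\<close>

lemma finite_subspace_of_dim_pos:
  fixes s :: "'a::{field,finite} \<Rightarrow> 'b::ab_group_add \<Rightarrow> 'b"
  assumes "vector_space s" and S: "module.subspace s S" and "vector_space.dim s S > 0"
  shows "finite S"
proof -
  interpret vector_space s by fact
  obtain B where B: "B \<subseteq> S" "independent B" "S \<subseteq> span B" "card B = dim S"
    using basis_exists by blast
  then have "finite B" using assms(3) by (metis card.infinite less_numeral_extra(3))
  then show ?thesis using card_span_independent[of B] B finite_subset by auto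
qed

theorem theorem12:
  fixes scale :: "'a::{field,finite} \<Rightarrow> 'v::ab_group_add \<Rightarrow> 'v"
    and M :: "('v \<Rightarrow> 'v \<Rightarrow> 'a) set"
    and lam mu :: 'a
    and q n r :: nat
  assumes "\<exists>B. finite_dimensional_vector_space scale B"
    and "q = CARD('a)"
    and "n = vector_space.dim scale (UNIV :: 'v set)"
    and "irreducible [:mu, lam, 1:]"
    and "0 < r" and "r < n" and "even r \<longleftrightarrow> odd n"
    and "M \<subseteq> Symm scale"
    and "module.subspace form_scale M"
    and "vector_space.dim form_scale M = 2 * n - r"
    and "\<forall>f\<in>M. f \<noteq> 0 \<longrightarrow> form_rank scale f = r \<or> form_rank scale f = n"
  shows "num_rank scale M r \<ge> q ^ n - 1 \<and>
    num_rank scale M n \<le> q ^ (2 * n - r) - q ^ n \<and>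
    (odd r \<and> even n \<longrightarrow>
       num_rank scale M r = q ^ n - 1 \<and>
       num_rank scale M n = q ^ (2 * n - r) - q ^ n \<and>
       card (Z_pairs M) = 2 * q ^ n - 1 \<and>
       card (N_pairs lam mu M) = 1 \<and>
       (\<forall>u. u \<noteq> 0 \<longrightarrow> vector_space.dim form_scale (forms_rad_at M u) = n - r) \<and>
       ((\<exists>k. q = 2 ^ k) \<longrightarrow> vector_space.dim form_scale (alt_forms M) = n - r)) \<and>
    (even r \<and> odd n \<longrightarrow>
       card (N_pairs lam mu M) \<ge> 2 * q ^ r - 1 \<and>
       (num_rank scale M r = q ^ n - 1 \<longleftrightarrow> card (N_pairs lam mu M) = 2 * q ^ r - 1) \<and>
       (card (N_pairs lam mu M) = 2 * q ^ r - 1 \<longleftrightarrow> card (Z_pairs M) = 2 * q ^ n - 1))"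
proof -
  obtain B where "finite_dimensional_vector_space scale B" using assms(1) by blast
  then interpret V: finite_dimensional_vector_space scale B .
  interpret F: vector_space "form_scale :: 'a \<Rightarrow> ('v \<Rightarrow> 'v \<Rightarrow> 'a) \<Rightarrow> _"
    by (rule vector_space_form_scale)
  have q2: "q \<ge> 2" using card_field_ge_2[where 'a = 'a] assms(2) by simp
  have fin: "finite M"
    using assms(5,6,9,10) by (intro finite_subspace_of_dim_pos[OF vector_space_form_scale]) auto
  have finV: "finite (UNIV :: 'v set)"
    using V.card_span_independent[OF _ V.finite_Basis V.independent_Basis] V.span_Basis by simp
  interpret finite_form_space scale M
    by unfold_locales (use finV assms fin in auto)
  have cardV: "CARD('v) = q ^ n"
    using V.card_subspace[of UNIV] finV assms(2,3) by simp
  have cardM: "card M = q ^ (2 * n - r)"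
    using F.card_subspace[of M] fin assms(2,9,10) by simp

  let ?R = "form_rank scale"
  define a where "a = int (q ^ r)"
  define d where "d = int (q ^ (n - r))"
  define Ar where "Ar = int (num_rank scale M r)"
  define An where "An = int (num_rank scale M n)"
  define z where "z = int (card (Z_pairs M))"
  define m where "m = int (card (N_pairs lam mu M))"
  have "q ^ 1 \<le> q ^ (n - r)" using assms(6) q2 by (intro power_increasing) auto
  then have d: "d \<ge> 2" using q2 by (simp add: d_def del: of_nat_power)
  have a: "a \<ge> 1" using q2 by (simp add: a_def)
  have qn: "int (q ^ n) = a * d"
    using assms(6) by (simp add: a_def d_def flip: power_add)
  have qm: "int (q ^ (2 * n - r)) = a * d * d"
  proof -
    have "2 * n - r = n + (n - r)" using assms(6) by simp
    then show ?thesis using qn by (simp add: d_def power_add)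
  qed
  have sum_rank: "(\<Sum>f\<in>M. h (?R f)) = h 0 + Ar * h r + An * h n" for h :: "nat \<Rightarrow> int"
  proof -
    have zero: "0 \<in> M" using assms(9) by (rule F.subspace_0)
    have rank0: "?R 0 = 0" by (simp add: form_rank_def form_rad_def)
    have split: "M - {0} = {f \<in> M. ?R f = r} \<union> {f \<in> M. ?R f = n}"
      using assms(5,6,11) rank0 by auto
    have "(\<Sum>f\<in>M. h (?R f)) = h (?R 0) + (\<Sum>f\<in>M - {0}. h (?R f))"
      using fin zero by (rule sum.remove)
    also have "(\<Sum>f\<in>M - {0}. h (?R f)) =
        (\<Sum>f\<in>{f \<in> M. ?R f = r}. h (?R f)) + (\<Sum>f\<in>{f \<in> M. ?R f = n}. h (?R f))"
      unfolding split using fin assms(6) by (intro sum.union_disjoint) auto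
    finally show ?thesis unfolding rank0 by (simp add: Ar_def An_def num_rank_def)
  qed
  have rad: "int CARD('v) * int (card (form_rad f)) = int (q ^ n * q ^ (n - ?R f))" if "f \<in> M" for f
    using finite_symmetric_form.card_form_rad[OF form[OF that]] cardV assms(2,3) by simp

  have total: "Ar + An = a * d * d - 1"
    using sum_rank[of "\<lambda>_. 1"] cardM qm by simp
  have "a * d * (d * z) = a * d * (a * d + Ar * d + An)"
  proof -
    have "a * d * (d * z) = (\<Sum>f\<in>M. int (q ^ n * q ^ (n - ?R f)))"
      using card_Z_pairs rad cardM qm by (simp add: z_def)
    also have "\<dots> = int (q ^ n * q ^ n) + Ar * int (q ^ n * q ^ (n - r)) + An * int (q ^ n)"
      using sum_rank[of "\<lambda>k. int (q ^ n * q ^ (n - k))"] by simp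
    also have "\<dots> = a * d * (a * d + Ar * d + An)"
      unfolding of_nat_mult qn d_def[symmetric] by (simp add: algebra_simps)
    finally show ?thesis .
  qed
  then have "d * z = a * d + Ar * d + An"
    using a d by simp
  then have Z: "d * (z - (2 * (a * d) - 1)) = (d - 1) * (Ar - (a * d - 1))"
    using total by (simp add: algebra_simps)
  have "a * d * (d * m) = a * d * (a * d + (- 1) ^ r * Ar * d + (- 1) ^ n * An)"
  proof -
    have "a * d * (d * m) = (\<Sum>f\<in>M. (- 1) ^ ?R f * int (q ^ n * q ^ (n - ?R f)))"
      using card_N_pairs[OF assms(4)] rad cardM qm by (simp add: m_def)
    also have "\<dots> = int (q ^ n * q ^ n) + Ar * ((- 1) ^ r * int (q ^ n * q ^ (n - r))) +
        An * ((- 1) ^ n * int (q ^ n))"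
      using sum_rank[of "\<lambda>k. (- 1) ^ k * int (q ^ n * q ^ (n - k))"] by simp
    also have "\<dots> = a * d * (a * d + (- 1) ^ r * Ar * d + (- 1) ^ n * An)"
      unfolding of_nat_mult qn d_def[symmetric] by (simp add: algebra_simps)
    finally show ?thesis .
  qed
  then have N: "d * m = a * d + (- 1) ^ r * Ar * d + (- 1) ^ n * An"
    using a d by simp
  have z_ge: "z \<ge> 2 * (a * d) - 1"
  proof -
    have "finite (Z_pairs M)" using finV by (auto intro: finite_subset[OF subset_UNIV] simp: finite_prod)
    then have "2 * q ^ n - 1 \<le> card (Z_pairs M)"
      using card_mono[OF _ trivial_pairs_subset] card_trivial_pairs cardV by simp
    then show ?thesis unfolding z_def qn[symmetric] by linarith
  qed
  have Ar_ge: "Ar \<ge> a * d - 1"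
  proof -
    have "0 \<le> (d - 1) * (Ar - (a * d - 1))" using d z_ge by (subst Z[symmetric]) simp
    then show ?thesis using d by (simp add: zero_le_mult_iff)
  qed
  have Z_iff: "z = 2 * (a * d) - 1 \<longleftrightarrow> Ar = a * d - 1"
    using Z d by auto
  have pos: "q ^ n \<ge> 1" "q ^ r \<ge> 1" "q ^ n \<le> q ^ (2 * n - r)"
    using q2 assms(6) by (auto intro: power_increasing)
  have qr: "int (q ^ r) = a" by (simp only: a_def)
  \<comment> \<open>The natural-number subtractions in the claims never truncate.\<close>
  have nat_iffs: "num_rank scale M r \<ge> q ^ n - 1 \<longleftrightarrow> Ar \<ge> a * d - 1"
    "num_rank scale M r = q ^ n - 1 \<longleftrightarrow> Ar = a * d - 1"
    "num_rank scale M n \<le> q ^ (2 * n - r) - q ^ n \<longleftrightarrow> An \<le> a * d * d - a * d"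
    "num_rank scale M n = q ^ (2 * n - r) - q ^ n \<longleftrightarrow> An = a * d * d - a * d"
    "card (Z_pairs M) = 2 * q ^ n - 1 \<longleftrightarrow> z = 2 * (a * d) - 1"
    "card (N_pairs lam mu M) = 2 * q ^ r - 1 \<longleftrightarrow> m = 2 * a - 1"
    "card (N_pairs lam mu M) \<ge> 2 * q ^ r - 1 \<longleftrightarrow> m \<ge> 2 * a - 1"
    using pos qn qm qr unfolding Ar_def An_def z_def m_def
    by (intro iffI; linarith)+

  \<comment> \<open>Here the Hermitian count gives the upper bound on the number of forms of rank \<open>r\<close> that matches
    the lower bound from \<open>Z_pairs M\<close>.\<close>
  have case_a: "num_rank scale M r = q ^ n - 1 \<and>
       num_rank scale M n = q ^ (2 * n - r) - q ^ n \<and>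
       card (Z_pairs M) = 2 * q ^ n - 1 \<and>
       card (N_pairs lam mu M) = 1 \<and>
       (\<forall>u. u \<noteq> 0 \<longrightarrow> F.dim (forms_rad_at M u) = n - r) \<and>
       ((\<exists>k. q = 2 ^ k) \<longrightarrow> F.dim (alt_forms M) = n - r)"
    if "odd r" "even n"
  proof -
    have finN: "finite (N_pairs lam mu M)" and finZ: "finite (Z_pairs M)"
      using finV by (auto intro: finite_subset[OF subset_UNIV] simp: finite_prod)
    have N0: "{(0, 0)} \<subseteq> N_pairs lam mu M"
    proof -
      have "f 0 0 + lam * f 0 0 + mu * f 0 0 = 0" if "f \<in> M" for f
        using finite_symmetric_form.form_zero_left[OF form[OF that], of 0] by simp
      then show ?thesis by (simp add: N_pairs_def)
    qed
    have eq: "d * (m - 1) = (d + 1) * ((a * d - 1) - Ar)"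
      using N total that by (simp add: algebra_simps)
    have "m \<ge> 1" using card_mono[OF finN N0] by (simp add: m_def)
    then have "0 \<le> (d + 1) * ((a * d - 1) - Ar)" using d by (subst eq[symmetric]) simp
    then have Ar: "Ar = a * d - 1" using d Ar_ge by (simp add: zero_le_mult_iff)
    then have m: "m = 1" using eq d by simp
    have "card (N_pairs lam mu M) = card {(0 :: 'v, 0 :: 'v)}" using m by (simp add: m_def)
    then have NN: "N_pairs lam mu M = {(0, 0)}" using card_subset_eq[OF finN N0] by simp
    have cZ: "card (Z_pairs M) = 2 * q ^ n - 1" using Ar Z_iff nat_iffs by simp
    then have ZZ: "UNIV \<times> {0} \<union> {0} \<times> UNIV = Z_pairs M"
      using card_subset_eq[OF finZ trivial_pairs_subset] card_trivial_pairs cardV by simp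
    \<comment> \<open>Both remaining dimensions are read off from a subspace of index \<open>q^n\<close> in \<open>M\<close>.\<close>
    have dim: "F.dim S = n - r"
      if S: "F.subspace S" "S \<subseteq> M" and card: "int (card M) = int CARD('v) * int (card S)" for S
    proof -
      have "a * d * int (card S) = a * d * d" using card cardM cardV qn qm by simp
      then have "card S = q ^ (n - r)" using a d q2 by (simp add: d_def flip: of_nat_power)
      moreover have "card S = q ^ F.dim S"
        using F.card_subspace[of S] S finite_subset[OF _ fin] assms(2) by simp
      ultimately show ?thesis using q2 by simp
    qed
    have "F.dim (forms_rad_at M u) = n - r" if "u \<noteq> 0" for u
    proof (rule dim)
      show "F.subspace (forms_rad_at M u)"
        using assms(9) by (auto simp: F.subspace_def forms_rad_at_def form_rad_def form_scale_def)
      have "v = 0" if "\<forall>f\<in>M. f u v = 0" for v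
        using that \<open>u \<noteq> 0\<close> ZZ by (auto simp: Z_pairs_def)
      then show "int (card M) = int CARD('v) * int (card (forms_rad_at M u))"
        by (rule card_forms_rad_at)
    qed (auto simp: forms_rad_at_def)
    moreover have "F.dim (alt_forms M) = n - r" if "q = 2 ^ k" for k
    proof (rule dim)
      show "F.subspace (alt_forms M)"
        using assms(9) by (auto simp: F.subspace_def alt_forms_def form_scale_def)
      have "u = 0" if "\<forall>f\<in>M. f u u = 0" for u
      proof -
        \<comment> \<open>A vector at which all diagonal values vanish gives a pair in \<open>N_pairs lam mu M\<close>, which is trivial.\<close>
        have "(u, 0) \<in> N_pairs lam mu M"
        proof -
          have "f u u + lam * f u 0 + mu * f 0 0 = 0" if "f \<in> M" for f
            using finite_symmetric_form.form_zero_right[OF form[OF that]] \<open>\<forall>f\<in>M. f u u = 0\<close> that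
            by simp
          then show ?thesis by (simp add: N_pairs_def)
        qed
        then show ?thesis using NN by simp
      qed
      then show "int (card M) = int CARD('v) * int (card (alt_forms M))"
        using power_2_card_imp_char_2 that assms(2) by (intro card_alt_forms) auto
    qed (auto simp: alt_forms_def)
    ultimately show ?thesis
      using cZ Ar total m nat_iffs by (auto simp: m_def)
  qed

  \<comment> \<open>Here the Hermitian count is an increasing function of the number of forms of rank \<open>r\<close>, so it
    only transports the lower bound.\<close>
  have case_b: "m \<ge> 2 * a - 1 \<and> (Ar = a * d - 1 \<longleftrightarrow> m = 2 * a - 1)" if "even r" "odd n"
  proof -
    have eq: "d * (m - (2 * a - 1)) = (d + 1) * (Ar - (a * d - 1))"
      using N total that by (simp add: algebra_simps)
    have "0 \<le> d * (m - (2 * a - 1))" using d Ar_ge by (subst eq) simp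
    then have "m \<ge> 2 * a - 1" using d by (simp add: zero_le_mult_iff)
    moreover have "Ar = a * d - 1 \<longleftrightarrow> m = 2 * a - 1" using eq d by auto
    ultimately show ?thesis by blast
  qed
  show ?thesis
    using case_a case_b Ar_ge Z_iff total unfolding nat_iffs by auto
qed

end
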